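(* Let $X_1,X_2$ be compact metric spaces, let $\phi_i\colon\mathbb{R}^+\times X_i\to X_i$ ($i=1,2$) be continuous-time dynamical systems (flows), and let $\Phi=\phi_1\times\phi_2$ be the product flow on $X_1\times X_2$, $\Phi(t,(x_1,x_2))=(\phi_1(t,x_1),\phi_2(t,x_2))$. Then, as partially ordered sets, $$\mathsf{RC}(\Phi)\cong\mathsf{RC}(\phi_1)\times\mathsf{RC}(\phi_2),$$ where the right-hand side carries the product order.
   Context: A continuous-time dynamical system (flow) on a compact metric space $X$ is a continuous map $\phi\colon\mathbb{R}^+\times X\to X$ with $\phi(0,x)=x$ and $\phi(t,\phi(s,x))=\phi(t+s,x)$; the time-$t$ maps are not assumed injective or surjective. For $U\subset X$, $\omega(U)=\bigcap_{t\ge0}\mathrm{cl}(\phi([t,\infty),U))$, and $\omega(x)=\omega(\{x\})$. A set $U\subset X$ is an attracting neighborhood if there is $\tau>0$ with $\phi(t,\mathrm{cl}(U))\subset\mathrm{int}(U)$ for all $t\ge\tau$. An attractor is a set of the form $\omega(U)$ with $U$ an attracting neighborhood; $\mathsf{Att}(\phi)$ is the set of attractors. The dual repeller of $A\in\mathsf{Att}(\phi)$ is $A^*=\{x\in X\mid\omega(x)\cap A=\emptyset\}$. The (chain) recurrent set is $\mathcal R(\phi)=\bigcap_{A\in\mathsf{Att}(\phi)}(A\cup A^* )$. The set $\mathsf{RC}(\phi)$ of recurrent components is the set of equivalence classes of $\mathcal R(\phi)$ under: $x\sim x'$ iff for every $A\in\mathsf{Att}(\phi)$ either $x,x'\in A$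 or $x,x'\in A^*$. It is partially ordered by: $\xi\le\xi'$ iff for every $A\in\mathsf{Att}(\phi)$, $\xi'\subset A$ implies $\xi\subset A$. *)

theory Defs
  imports "HOL-Analysis.Analysis"
begin

text \<open>
  A compact metric space is a compact subset \<open>X\<close> of a metric space type (possibly empty), with
  the subspace topology. Closures and interiors are relative to \<open>X\<close>. A flow is a function
  on the whole type, of which only the values for \<open>t \<ge> 0\<close> and \<open>x \<in> X\<close> matter.
\<close>

definition flow_on :: "'a::metric_space set \<Rightarrow> (real \<Rightarrow> 'a \<Rightarrow> 'a) \<Rightarrow> bool" where
  "flow_on X \<phi> \<longleftrightarrow>
     continuous_on ({0..} \<times> X) (\<lambda>(t, x). \<phi> t x) \<and>
     (\<forall>t\<ge>0. \<forall>x\<in>X. \<phi> t x \<in> X) \<and>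
     (\<forall>x\<in>X. \<phi> 0 x = x) \<and>
     (\<forall>t\<ge>0. \<forall>s\<ge>0. \<forall>x\<in>X. \<phi> t (\<phi> s x) = \<phi> (t + s) x)"

definition prod_flow ::
  "(real \<Rightarrow> 'a \<Rightarrow> 'a) \<Rightarrow> (real \<Rightarrow> 'b \<Rightarrow> 'b) \<Rightarrow> real \<Rightarrow> 'a \<times> 'b \<Rightarrow> 'a \<times> 'b" where
  "prod_flow \<phi>\<^sub>1 \<phi>\<^sub>2 = (\<lambda>t (x\<^sub>1, x\<^sub>2). (\<phi>\<^sub>1 t x\<^sub>1, \<phi>\<^sub>2 t x\<^sub>2))"

definition omega_limit ::
  "'a::metric_space set \<Rightarrow> (real \<Rightarrow> 'a \<Rightarrow> 'a) \<Rightarrow> 'a set \<Rightarrow> 'a set" where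
  "omega_limit X \<phi> U = (\<Inter>t\<in>{0..}. top_of_set X closure_of (\<Union>s\<in>{t..}. \<phi> s ` U))"

definition attracting_nbhd ::
  "'a::metric_space set \<Rightarrow> (real \<Rightarrow> 'a \<Rightarrow> 'a) \<Rightarrow> 'a set \<Rightarrow> bool" where
  "attracting_nbhd X \<phi> U \<longleftrightarrow>
     U \<subseteq> X \<and>
     (\<exists>\<tau>>0. \<forall>t\<ge>\<tau>. \<phi> t ` (top_of_set X closure_of U) \<subseteq> top_of_set X interior_of U)"

definition attractors :: "'a::metric_space set \<Rightarrow> (real \<Rightarrow> 'a \<Rightarrow> 'a) \<Rightarrow> 'a set set" where
  "attractors X \<phi> = {omega_limit X \<phi> U |U. attracting_nbhd X \<phi> U}"

definition dual_repeller ::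
  "'a::metric_space set \<Rightarrow> (real \<Rightarrow> 'a \<Rightarrow> 'a) \<Rightarrow> 'a set \<Rightarrow> 'a set" where
  "dual_repeller X \<phi> A = {x \<in> X. omega_limit X \<phi> {x} \<inter> A = {}}"

text \<open>
  The family of attractors is never empty (\<open>X\<close> is an attracting neighborhood of itself), so the
  intersection below is contained in \<open>X\<close>.
\<close>

definition recurrent_set :: "'a::metric_space set \<Rightarrow> (real \<Rightarrow> 'a \<Rightarrow> 'a) \<Rightarrow> 'a set" where
  "recurrent_set X \<phi> = (\<Inter>A\<in>attractors X \<phi>. A \<union> dual_repeller X \<phi> A)"

definition recurrent_equiv ::
  "'a::metric_space set \<Rightarrow> (real \<Rightarrow> 'a \<Rightarrow> 'a) \<Rightarrow> ('a \<times> 'a) set" where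
  "recurrent_equiv X \<phi> =
     {(x, x'). x \<in> recurrent_set X \<phi> \<and> x' \<in> recurrent_set X \<phi> \<and>
        (\<forall>A\<in>attractors X \<phi>. (x \<in> A \<and> x' \<in> A) \<or>
           (x \<in> dual_repeller X \<phi> A \<and> x' \<in> dual_repeller X \<phi> A))}"

definition recurrent_components ::
  "'a::metric_space set \<Rightarrow> (real \<Rightarrow> 'a \<Rightarrow> 'a) \<Rightarrow> 'a set set" where
  "recurrent_components X \<phi> = recurrent_set X \<phi> // recurrent_equiv X \<phi>"

definition rc_order ::
  "'a::metric_space set \<Rightarrow> (real \<Rightarrow> 'a \<Rightarrow> 'a) \<Rightarrow> ('a set \<times> 'a set) set" where
  "rc_order X \<phi> =
     {(\<xi>, \<xi>'). \<xi> \<in> recurrent_components X \<phi> \<and> \<xi>' \<in> recurrent_components X \<phi> \<and>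
        (\<forall>A\<in>attractors X \<phi>. \<xi>' \<subseteq> A \<longrightarrow> \<xi> \<subseteq> A)}"

definition prod_order :: "('a \<times> 'a) set \<Rightarrow> ('b \<times> 'b) set \<Rightarrow> (('a \<times> 'b) \<times> ('a \<times> 'b)) set" where
  "prod_order r s = {((a, b), (a', b')). (a, a') \<in> r \<and> (b, b') \<in> s}"

definition order_isomorphic ::
  "'a set \<Rightarrow> ('a \<times> 'a) set \<Rightarrow> 'b set \<Rightarrow> ('b \<times> 'b) set \<Rightarrow> bool" where
  "order_isomorphic P r Q s \<longleftrightarrow>
     (\<exists>f. bij_betw f P Q \<and> (\<forall>x\<in>P. \<forall>y\<in>P. (x, y) \<in> r \<longleftrightarrow> (f x, f y) \<in> s))"

lemma omega_limit_subset: "omega_limit X \<phi> U \<subseteq> X"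
  unfolding omega_limit_def using closure_of_subset_topspace[of "top_of_set X"] by force

lemma attractor_disjoint_dual:
  assumes X: "compact X" and f: "flow_on X \<phi>" and A: "A \<in> attractors X \<phi>"
  shows "A \<inter> dual_repeller X \<phi> A = {}"
proof -
  obtain U where U: "attracting_nbhd X \<phi> U" and AU: "A = omega_limit X \<phi> U"
    using A by (auto simp: attractors_def)
  have UX: "U \<subseteq> X" using U by (auto simp: attracting_nbhd_def)
  have tr: "\<phi> t ` X \<subseteq> X" if "t \<ge> 0" for t
    using f that by (auto simp: flow_on_def)
  have cl: "top_of_set X closure_of S = closure S" if "S \<subseteq> X" for S
    using that closure_minimal[OF that compact_imp_closed[OF X]]
    by (simp add: closure_of_subtopology inf.absorb2)
  have orb: "(\<Union>s\<in>{t..}. \<phi> s ` S) \<subseteq> X" if "t \<ge> 0" "S \<subseteq> X" for t S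
  proof
    fix y assume "y \<in> (\<Union>s\<in>{t..}. \<phi> s ` S)"
    then obtain s x where "s \<ge> t" "x \<in> S" "y = \<phi> s x" by auto
    with that f show "y \<in> X" by (auto simp: flow_on_def)
  qed
  have inv: "\<phi> r x \<in> A" if x: "x \<in> A" and r: "r \<ge> 0" for x r
  proof -
    have xX: "x \<in> X" using x AU omega_limit_subset by blast
    have cont: "continuous_on X (\<phi> r)"
    proof -
      have "continuous_on X ((\<lambda>(t, x). \<phi> t x) \<circ> (\<lambda>x. (r, x)))"
        using f r by (intro continuous_on_compose continuous_intros)
          (auto simp: flow_on_def elim!: continuous_on_subset)
      then show ?thesis by (simp add: o_def)
    qed
    have "\<phi> r x \<in> closure (\<Union>s\<in>{t..}. \<phi> s ` U)" if t: "t \<ge> 0" for t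
    proof -
      let ?O = "\<Union>s\<in>{t..}. \<phi> s ` U"
      have "x \<in> closure ?O"
        using x t cl[OF orb[OF t UX]] by (auto simp: AU omega_limit_def)
      moreover have "closure ?O \<subseteq> X"
        using closure_minimal[OF orb[OF t UX] compact_imp_closed[OF X]] .
      ultimately have "\<phi> r x \<in> closure (\<phi> r ` ?O)"
        using image_closure_subset[OF continuous_on_subset[OF cont] closed_closure closure_subset]
        by (meson image_subset_iff)
      moreover have "\<phi> r ` ?O \<subseteq> ?O"
      proof
        fix y assume "y \<in> \<phi> r ` ?O"
        then obtain s u where su: "s \<ge> t" "u \<in> U" "y = \<phi> r (\<phi> s u)" by auto
        then have "y = \<phi> (r + s) u" using f r t UX by (auto simp: flow_on_def)
        then show "y \<in> ?O" using su r by (intro UN_I[of "r + s"]) auto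
      qed
      ultimately show ?thesis by (meson closure_mono subsetD)
    qed
    then show ?thesis using cl[OF orb[OF _ UX]] by (auto simp: AU omega_limit_def)
  qed
  have clA: "closed A"
    unfolding AU omega_limit_def using cl[OF orb[OF _ UX]] by (intro closed_INT) auto
  have "omega_limit X \<phi> {x} \<inter> A \<noteq> {}" if x: "x \<in> A" for x
  proof -
    have xX: "x \<in> X" using x AU omega_limit_subset by blast
    let ?F = "\<lambda>t. closure (\<Union>s\<in>{t..}. \<phi> s ` {x})"
    have "A \<inter> (\<Inter>t\<in>{0..}. ?F t) \<noteq> {}"
    proof (rule compact_imp_fip_image)
      show "compact A" using X clA omega_limit_subset AU
        by (metis compact_Int_closed inf.absorb_iff2)
      fix I assume I: "finite I" "I \<subseteq> {0::real..}"
      define m where "m = Max (insert 0 I)"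
      have m: "m \<ge> 0" "\<And>t. t \<in> I \<Longrightarrow> t \<le> m" using I by (auto simp: m_def)
      have "\<phi> m x \<in> ?F t" if "t \<in> I" for t
        using m(2)[OF that] by (intro subsetD[OF closure_subset]) auto
      then show "A \<inter> (\<Inter>t\<in>I. ?F t) \<noteq> {}" using inv[OF x m(1)] by blast
    qed auto
    moreover have "omega_limit X \<phi> {x} = (\<Inter>t\<in>{0..}. ?F t)"
      unfolding omega_limit_def using cl[OF orb[of _ "{x}"]] xX by (intro INF_cong) auto
    ultimately show ?thesis by blast
  qed
  then show ?thesis by (auto simp: dual_repeller_def)
qed

text \<open>
  The relations above are an equivalence on the recurrent set and a partial order on the recurrent
  components, so that the latter form a poset.
\<close>

lemma equiv_recurrent_equiv:
  assumes "compact X" "flow_on X \<phi>"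
  shows "equiv (recurrent_set X \<phi>) (recurrent_equiv X \<phi>)"
proof (rule equivI)
  show "recurrent_equiv X \<phi> \<subseteq> recurrent_set X \<phi> \<times> recurrent_set X \<phi>"
    by (auto simp: recurrent_equiv_def)
  show "refl_on (recurrent_set X \<phi>) (recurrent_equiv X \<phi>)"
    by (auto simp: refl_on_def recurrent_equiv_def recurrent_set_def)
  show "sym (recurrent_equiv X \<phi>)"
    by (auto simp: sym_def recurrent_equiv_def)
  show "trans (recurrent_equiv X \<phi>)"
    using attractor_disjoint_dual[OF assms] unfolding trans_def recurrent_equiv_def by blast
qed

lemma partial_order_rc_order:
  assumes "compact X" "flow_on X \<phi>"
  shows "partial_order_on (recurrent_components X \<phi>) (rc_order X \<phi>)"
proof -
  note E = equiv_recurrent_equiv[OF assms]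
  have sub: "\<xi> \<subseteq> A \<longleftrightarrow> x \<in> A"
    if "\<xi> \<in> recurrent_components X \<phi>" "x \<in> \<xi>" "A \<in> attractors X \<phi>" for \<xi> x A
    using that quotient_eq_iff[OF E, of \<xi> \<xi>] attractor_disjoint_dual[OF assms that(3)]
    unfolding recurrent_components_def recurrent_equiv_def by blast
  have ne: "\<exists>x. x \<in> \<xi>" "\<xi> \<subseteq> recurrent_set X \<phi>" if "\<xi> \<in> recurrent_components X \<phi>" for \<xi>
    using that in_quotient_imp_non_empty[OF E] in_quotient_imp_subset[OF E]
    unfolding recurrent_components_def by blast+
  have "\<xi> = \<eta>" if a: "(\<xi>, \<eta>) \<in> rc_order X \<phi>" "(\<eta>, \<xi>) \<in> rc_order X \<phi>" for \<xi> \<eta>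
  proof -
    have R: "\<xi> \<in> recurrent_components X \<phi>" "\<eta> \<in> recurrent_components X \<phi>"
      using a by (auto simp: rc_order_def)
    obtain x y where xy: "x \<in> \<xi>" "y \<in> \<eta>"
      using ne(1)[OF R(1)] ne(1)[OF R(2)] by auto
    have iff: "x \<in> A \<longleftrightarrow> y \<in> A" if "A \<in> attractors X \<phi>" for A
      using a sub[OF R(1) xy(1) that] sub[OF R(2) xy(2) that] that by (auto simp: rc_order_def)
    have rr: "x \<in> recurrent_set X \<phi>" "y \<in> recurrent_set X \<phi>" using ne(2)[OF R(1)] ne(2)[OF R(2)] xy by auto
    then have "(x, y) \<in> recurrent_equiv X \<phi>"
      using iff unfolding recurrent_equiv_def recurrent_set_def by blast
    then show ?thesis
      using quotient_eq_iff[OF E] R xy unfolding recurrent_components_def by blast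
  qed
  then show ?thesis
    unfolding partial_order_on_def preorder_on_def
    by (auto simp: refl_on_def trans_def antisym_def rc_order_def)
qed

end

theory Submission
  imports Defs
begin

text \<open>
  Attractors of a factor pull back along the projections, which are semiconjugacies. So recurrence
  of a pair, and any comparison of two pairs by attractors, pass to the coordinates; this is the
  easy half. The difficulty is the converse: an attractor of the product flow need not be built
  from products of attractors, so the attractors of the factors do not determine it directly. The
  bridge is pseudo-orbits: sequences that follow the flow for a time \<open>T\<close>, jump by less than
  \<open>\<epsilon>\<close>, and repeat.

  On the one hand, if \<open>y\<close> is reached from \<open>x\<close> by pseudo-orbits for all \<open>\<epsilon>\<close> and \<open>T\<close>, then \<open>y\<close>
  lies in each attractor whose dual repeller misses \<open>x\<close>: small jumps cannot leave an attracting
  neighborhood, and large \<open>T\<close> pushes the end point onto the attractor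
  (\<open>reachable_imp_mem_attractor\<close>). On the other hand, if \<open>x\<close> is recurrent and \<open>y\<close> lies in all
  attractors that contain \<open>x\<close>, then \<open>y\<close> is reached from \<open>x\<close>, because the reachable points form an
  attracting neighborhood that the orbit of \<open>x\<close> enters.

  Two pseudo-orbits combine to one of the product flow only if they have equally many jumps. For
  iterated maps the numbers cannot always be matched, and the analogous product formula is false:
  two cycles of period 2 have a product with two components. A flow has the freedom to change the times between jumps a little. A long near-return of the orbit of \<open>x\<close>
  can be cut into \<open>k\<close> steps of length \<open>T\<close> or into \<open>k + 1\<close> slightly shorter ones, and the discrepancy
  is absorbed by the jumps. Loops with \<open>k\<close> and with \<open>k + 1\<close> jumps give loops with any large number
  of jumps. Hence reachability can be strengthened to \<^emph>\<open>reachability by pseudo-orbits with any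
  sufficiently large number of jumps\<close> (\<open>below_imp_eventually_reachable\<close>), and that property
  is inherited by products.

  Together these facts show that the recurrent set of the product is the product of the recurrent
  sets, and that the preorder given by the attractors is the product preorder. The statement on
  posets follows by passing to equivalence classes.
\<close>

section \<open>Flows in metric terms\<close>

lemma flow_onD:
  assumes "flow_on X \<phi>"
  shows flow_on_in: "\<And>t x. t \<ge> 0 \<Longrightarrow> x \<in> X \<Longrightarrow> \<phi> t x \<in> X"
    and flow_on_zero: "\<And>x. x \<in> X \<Longrightarrow> \<phi> 0 x = x"
    and flow_on_add: "\<And>t s x. t \<ge> 0 \<Longrightarrow> s \<ge> 0 \<Longrightarrow> x \<in> X \<Longrightarrow> \<phi> t (\<phi> s x) = \<phi> (t + s) x"
  using assms by (auto simp: flow_on_def)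

lemma flow_on_continuous_at_time:
  assumes "flow_on X \<phi>" "t \<ge> 0"
  shows "continuous_on X (\<phi> t)"
proof -
  have "continuous_on X ((\<lambda>(t, x). \<phi> t x) \<circ> (\<lambda>x. (t, x)))"
    using assms by (intro continuous_on_compose continuous_intros)
      (auto simp: flow_on_def elim!: continuous_on_subset)
  then show ?thesis by (simp add: o_def)
qed

lemma closure_of_compact_subspace:
  fixes X :: "'a::metric_space set"
  assumes "compact X" "S \<subseteq> X"
  shows "top_of_set X closure_of S = closure S"
  using assms closure_minimal[OF assms(2) compact_imp_closed[OF assms(1)]]
  by (simp add: closure_of_subtopology inf.absorb2)

lemma mem_interior_of_subspace_iff:
  fixes X :: "'a::metric_space set"
  shows "x \<in> top_of_set X interior_of U \<longleftrightarrow> x \<in> X \<and> x \<in> U \<and> (\<exists>\<delta>>0. \<forall>y\<in>X. dist x y < \<delta> \<longrightarrow> y \<in> U)"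
proof
  assume "x \<in> top_of_set X interior_of U"
  then obtain V where V: "openin (top_of_set X) V" "x \<in> V" "V \<subseteq> U"
    by (auto simp: interior_of_def)
  then show "x \<in> X \<and> x \<in> U \<and> (\<exists>\<delta>>0. \<forall>y\<in>X. dist x y < \<delta> \<longrightarrow> y \<in> U)"
    unfolding openin_euclidean_subtopology_iff by (metis dist_commute subsetD)
next
  assume R: "x \<in> X \<and> x \<in> U \<and> (\<exists>\<delta>>0. \<forall>y\<in>X. dist x y < \<delta> \<longrightarrow> y \<in> U)"
  then obtain \<delta> where \<delta>: "\<delta> > 0" "\<forall>y\<in>X. dist x y < \<delta> \<longrightarrow> y \<in> U" by blast
  have "openin (top_of_set X) (X \<inter> ball x \<delta>)" by auto
  moreover have "x \<in> X \<inter> ball x \<delta>" "X \<inter> ball x \<delta> \<subseteq> U" using R \<delta> by auto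
  ultimately show "x \<in> top_of_set X interior_of U" unfolding interior_of_def by blast
qed

lemma mem_omega_limit_iff:
  assumes "compact X" "flow_on X \<phi>" "U \<subseteq> X"
  shows "y \<in> omega_limit X \<phi> U \<longleftrightarrow> (\<forall>t\<ge>0. \<forall>\<epsilon>>0. \<exists>s\<ge>t. \<exists>u\<in>U. dist (\<phi> s u) y < \<epsilon>)"
proof -
  have "(\<Union>s\<in>{t..}. \<phi> s ` U) \<subseteq> X" if "t \<ge> 0" for t
  proof (intro UN_least image_subsetI)
    fix s u assume "s \<in> {t..}" "u \<in> U"
    then show "\<phi> s u \<in> X" using that assms(3) flow_on_in[OF assms(2), of s u] by auto
  qed
  then have "omega_limit X \<phi> U = (\<Inter>t\<in>{0..}. closure (\<Union>s\<in>{t..}. \<phi> s ` U))"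
    unfolding omega_limit_def using closure_of_compact_subspace[OF assms(1)] by (intro INF_cong) auto
  moreover have "y \<in> closure (\<Union>s\<in>{t..}. \<phi> s ` U) \<longleftrightarrow>
      (\<forall>\<epsilon>>0. \<exists>s\<ge>t. \<exists>u\<in>U. dist (\<phi> s u) y < \<epsilon>)" for t
    unfolding closure_approachable by (simp add: Bex_def) blast
  ultimately show ?thesis by (simp only: INT_iff Ball_def atLeast_iff)
qed

lemma mem_omega_limit_point_iff:
  assumes "compact X" "flow_on X \<phi>" "x \<in> X"
  shows "y \<in> omega_limit X \<phi> {x} \<longleftrightarrow> (\<forall>t\<ge>0. \<forall>\<epsilon>>0. \<exists>s\<ge>t. dist (\<phi> s x) y < \<epsilon>)"
  using mem_omega_limit_iff[OF assms(1,2), of "{x}" y] assms(3) by simp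

section \<open>Attracting neighborhoods\<close>

text \<open>
  By compactness the time-\<open>t\<close> images of an attracting neighborhood stay a fixed distance inside it,
  uniformly in \<open>t\<close>: times beyond \<open>2\<tau>\<close> are reduced to the compact range \<open>[\<tau>, 2\<tau>]\<close>, since
  the flow has by then returned to the neighborhood. This form makes no mention of closures and
  interiors and says directly that small errors are tolerated.
\<close>

lemma attracting_nbhd_iff_margin:
  assumes X: "compact X" and f: "flow_on X \<phi>"
  shows "attracting_nbhd X \<phi> U \<longleftrightarrow> U \<subseteq> X \<and>
    (\<exists>\<tau>>0. \<exists>\<epsilon>>0. \<forall>t\<ge>\<tau>. \<forall>u\<in>U. \<forall>y\<in>X. dist (\<phi> t u) y < \<epsilon> \<longrightarrow> y \<in> U)"
proof (intro iffI)
  assume A: "attracting_nbhd X \<phi> U"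
  have U: "U \<subseteq> X" using A by (simp add: attracting_nbhd_def)
  have clX: "closure U \<subseteq> X" by (simp add: U X closure_minimal compact_imp_closed)
  obtain \<tau> where \<tau>: "\<tau> > 0" "\<And>t. t \<ge> \<tau> \<Longrightarrow> \<phi> t ` closure U \<subseteq> top_of_set X interior_of U"
    using A closure_of_compact_subspace[OF X U] by (auto simp: attracting_nbhd_def)
  obtain G where G: "open G" "top_of_set X interior_of U = X \<inter> G"
    by (metis openin_interior_of openin_open)
  have GU: "X \<inter> G \<subseteq> U" using G(2) interior_of_subset by metis
  define K where "K = (\<lambda>(t, x). \<phi> t x) ` ({\<tau>..2*\<tau>} \<times> closure U)"
  have "compact K" unfolding K_def
  proof (rule compact_continuous_image)
    show "continuous_on ({\<tau>..2*\<tau>} \<times> closure U) (\<lambda>(t, x). \<phi> t x)"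
      using f \<tau>(1) clX unfolding flow_on_def by (elim conjE continuous_on_subset) auto
    have "compact (closure U)" using compact_Int_closed[OF X closed_closure, of U] clX by (simp add: inf.absorb2)
    then show "compact ({\<tau>..2*\<tau>} \<times> closure U)" by (intro compact_Times) auto
  qed
  moreover have "K \<subseteq> G"
    unfolding K_def using \<tau>(2) G(2) by (auto simp: image_subset_iff)
  ultimately obtain \<epsilon> where \<epsilon>: "\<epsilon> > 0" "(\<Union>x\<in>K. ball x \<epsilon>) \<subseteq> G"
    using compact_subset_open_imp_ball_epsilon_subset[OF _ G(1)] by blast
  have "y \<in> U" if "t \<ge> \<tau>" "u \<in> U" "y \<in> X" "dist (\<phi> t u) y < \<epsilon>" for t u y
  proof -
    have "\<phi> t u \<in> K"
    proof (cases "t \<le> 2 * \<tau>")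
      case True
      then have "(t, u) \<in> {\<tau>..2*\<tau>} \<times> closure U" using that closure_subset[of U] by auto
      then show ?thesis unfolding K_def by (intro image_eqI[of _ _ "(t, u)"]) auto
    next
      case False
      then have "\<phi> (t - \<tau>) ` closure U \<subseteq> U" using \<tau>(2)[of "t - \<tau>"] GU G(2) by (simp, blast)
      then have "\<phi> (t - \<tau>) u \<in> closure U" using that(2) closure_subset[of U] by blast
      moreover have "\<phi> t u = \<phi> \<tau> (\<phi> (t - \<tau>) u)"
        using flow_on_add[OF f, of \<tau> "t - \<tau>" u] False \<tau>(1) that U by auto
      ultimately show ?thesis
        using \<tau>(1) unfolding K_def by (intro image_eqI[of _ _ "(\<tau>, \<phi> (t - \<tau>) u)"]) auto
    qed
    then have "y \<in> G" using subsetD[OF \<epsilon>(2), of y] that(4) by (auto simp: mem_ball)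
    then show ?thesis using that(3) GU by blast
  qed
  then show "U \<subseteq> X \<and> (\<exists>\<tau>>0. \<exists>\<epsilon>>0. \<forall>t\<ge>\<tau>. \<forall>u\<in>U. \<forall>y\<in>X. dist (\<phi> t u) y < \<epsilon> \<longrightarrow> y \<in> U)"
    using U \<tau>(1) \<epsilon>(1) by blast
next
  assume A: "U \<subseteq> X \<and> (\<exists>\<tau>>0. \<exists>\<epsilon>>0. \<forall>t\<ge>\<tau>. \<forall>u\<in>U. \<forall>y\<in>X. dist (\<phi> t u) y < \<epsilon> \<longrightarrow> y \<in> U)"
  then obtain \<tau> \<epsilon> where U: "U \<subseteq> X" and \<tau>: "\<tau> > 0" "\<epsilon> > 0"
    and m: "\<And>t u y. t \<ge> \<tau> \<Longrightarrow> u \<in> U \<Longrightarrow> y \<in> X \<Longrightarrow> dist (\<phi> t u) y < \<epsilon> \<Longrightarrow> y \<in> U"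
    by blast
  have clX: "closure U \<subseteq> X" by (simp add: U X closure_minimal compact_imp_closed)
  have "\<phi> t x \<in> top_of_set X interior_of U" if t: "t \<ge> \<tau>" and x: "x \<in> closure U" for t x
  proof -
    have t0: "t \<ge> 0" using t \<tau> by simp
    have xX: "x \<in> X" using x clX by blast
    have tX: "\<phi> t x \<in> X" using flow_on_in[OF f t0 xX] .
    obtain d where d: "d > 0" "\<And>u. u \<in> X \<Longrightarrow> dist u x < d \<Longrightarrow> dist (\<phi> t u) (\<phi> t x) < \<epsilon>/2"
      using flow_on_continuous_at_time[OF f t0] xX \<tau>(2) unfolding continuous_on_iff
      by (meson half_gt_zero)
    obtain u where u: "u \<in> U" "dist u x < d" using x d(1) unfolding closure_approachable by blast
    then have du: "dist (\<phi> t u) (\<phi> t x) < \<epsilon>/2" using d(2) U by blast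
    have near: "y \<in> U" if "y \<in> X" "dist (\<phi> t x) y < \<epsilon>/2" for y
    proof (rule m[OF t u(1) that(1)])
      show "dist (\<phi> t u) y < \<epsilon>" using du that(2) dist_triangle[of "\<phi> t u" y "\<phi> t x"] by linarith
    qed
    then show ?thesis unfolding mem_interior_of_subspace_iff
      using tX \<tau>(2) near[OF tX] by (intro conjI exI[of _ "\<epsilon>/2"]) auto
  qed
  then show "attracting_nbhd X \<phi> U"
    unfolding attracting_nbhd_def closure_of_compact_subspace[OF X U] using U \<tau>(1) by blast
qed

lemma attracting_nbhdE:
  assumes "compact X" "flow_on X \<phi>" "attracting_nbhd X \<phi> U"
  obtains \<tau> \<epsilon> where "U \<subseteq> X" "\<tau> > 0" "\<epsilon> > 0"
    "\<And>t u y. t \<ge> \<tau> \<Longrightarrow> u \<in> U \<Longrightarrow> y \<in> X \<Longrightarrow> dist (\<phi> t u) y < \<epsilon> \<Longrightarrow> y \<in> U"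
  using assms attracting_nbhd_iff_margin by metis

lemma omega_limit_subset_attracting_nbhd:
  assumes X: "compact X" and f: "flow_on X \<phi>" and U: "attracting_nbhd X \<phi> U"
  shows "omega_limit X \<phi> U \<subseteq> U"
proof
  fix y assume y: "y \<in> omega_limit X \<phi> U"
  obtain \<tau> \<epsilon> where m: "U \<subseteq> X" "\<tau> > 0" "\<epsilon> > 0"
    "\<And>t u y. t \<ge> \<tau> \<Longrightarrow> u \<in> U \<Longrightarrow> y \<in> X \<Longrightarrow> dist (\<phi> t u) y < \<epsilon> \<Longrightarrow> y \<in> U"
    using attracting_nbhdE[OF assms] by metis
  have "\<exists>s\<ge>\<tau>. \<exists>u\<in>U. dist (\<phi> s u) y < \<epsilon>"
    using y m(2,3) unfolding mem_omega_limit_iff[OF X f m(1)] by simp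
  then show "y \<in> U" using m(4) y omega_limit_subset by blast
qed

lemma omega_limit_point_nonempty:
  assumes X: "compact X" and f: "flow_on X \<phi>" and x: "x \<in> X"
  shows "omega_limit X \<phi> {x} \<noteq> {}"
proof -
  have "\<forall>n. \<phi> (real n) x \<in> X" using flow_on_in[OF f _ x] by simp
  then obtain l r where r: "strict_mono r" "((\<lambda>n. \<phi> (real n) x) \<circ> r) \<longlonglongrightarrow> l"
    using X unfolding compact_def by metis
  have "\<exists>s\<ge>t. dist (\<phi> s x) l < \<epsilon>" if e: "\<epsilon> > 0" for t \<epsilon>
  proof -
    obtain N where N: "\<And>n. n \<ge> N \<Longrightarrow> dist (\<phi> (real (r n)) x) l < \<epsilon>"
      using r(2) e unfolding lim_sequentially o_def by metis
    define n where "n = max N (nat \<lceil>t\<rceil>)"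
    have "real (r n) \<ge> real n" using seq_suble[OF r(1)] by simp
    moreover have "real n \<ge> t" unfolding n_def by linarith
    moreover have "dist (\<phi> (real (r n)) x) l < \<epsilon>" using N[of n] by (simp add: n_def)
    ultimately show ?thesis by (intro exI[of _ "real (r n)"]) simp
  qed
  then have "l \<in> omega_limit X \<phi> {x}" unfolding mem_omega_limit_point_iff[OF X f x] by blast
  then show ?thesis by blast
qed

text \<open>
  A limit set depends only on what happens late, so that an orbit that visits \<open>U\<close> at a single time
  already has its whole limit set in that of \<open>U\<close>.
\<close>

lemma omega_limit_point_subset:
  assumes X: "compact X" and f: "flow_on X \<phi>" and U: "U \<subseteq> X" and x: "x \<in> X"
    and s: "s \<ge> 0" "\<phi> s x \<in> U"
  shows "omega_limit X \<phi> {x} \<subseteq> omega_limit X \<phi> U"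
proof
  fix y assume y: "y \<in> omega_limit X \<phi> {x}"
  have "\<exists>r\<ge>t. \<exists>u\<in>U. dist (\<phi> r u) y < \<epsilon>" if t: "t \<ge> 0" and e: "\<epsilon> > 0" for t \<epsilon>
  proof -
    have "t + s \<ge> 0" using t s by simp
    then obtain r where r: "r \<ge> t + s" "dist (\<phi> r x) y < \<epsilon>"
      using y e unfolding mem_omega_limit_point_iff[OF X f x] by blast
    have "\<phi> r x = \<phi> (r - s) (\<phi> s x)" using flow_on_add[OF f, of "r - s" s x] r(1) t s x by simp
    then show ?thesis using r s by (intro exI[of _ "r - s"]) auto
  qed
  then show "y \<in> omega_limit X \<phi> U" unfolding mem_omega_limit_iff[OF X f U] by blast
qed

text \<open>
  An orbit that accumulates at a point of the attractor comes within the margin of the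
  neighborhood. This turns the dual repeller, defined by limit sets, into a condition on orbits.
\<close>

lemma mem_dual_repeller_iff:
  assumes X: "compact X" and f: "flow_on X \<phi>" and U: "attracting_nbhd X \<phi> U" and x: "x \<in> X"
  shows "x \<in> dual_repeller X \<phi> (omega_limit X \<phi> U) \<longleftrightarrow> (\<forall>s\<ge>0. \<phi> s x \<notin> U)"
proof
  have UX: "U \<subseteq> X" using U by (simp add: attracting_nbhd_def)
  assume "x \<in> dual_repeller X \<phi> (omega_limit X \<phi> U)"
  then show "\<forall>s\<ge>0. \<phi> s x \<notin> U"
    using omega_limit_point_subset[OF X f UX x] omega_limit_point_nonempty[OF X f x]
    unfolding dual_repeller_def by blast
next
  assume never: "\<forall>s\<ge>0. \<phi> s x \<notin> U"
  obtain \<tau> \<epsilon> where m: "U \<subseteq> X" "\<tau> > 0" "\<epsilon> > 0"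
    "\<And>t u y. t \<ge> \<tau> \<Longrightarrow> u \<in> U \<Longrightarrow> y \<in> X \<Longrightarrow> dist (\<phi> t u) y < \<epsilon> \<Longrightarrow> y \<in> U"
    using attracting_nbhdE[OF X f U] by metis
  have False if a: "a \<in> omega_limit X \<phi> {x}" "a \<in> omega_limit X \<phi> U" for a
  proof -
    have e: "\<epsilon>/2 > 0" using m by simp
    obtain s where s: "s \<ge> 0" "dist (\<phi> s x) a < \<epsilon>/2"
      using a(1) e unfolding mem_omega_limit_point_iff[OF X f x] by blast
    obtain t u where t: "t \<ge> \<tau>" "u \<in> U" "dist (\<phi> t u) a < \<epsilon>/2"
      using a(2) e less_imp_le[OF m(2)] unfolding mem_omega_limit_iff[OF X f m(1)] by blast
    have "dist (\<phi> t u) (\<phi> s x) < \<epsilon>"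
      using s(2) t(3) dist_triangle2[of "\<phi> t u" "\<phi> s x" a] by linarith
    then show False using m(4)[OF t(1,2)] flow_on_in[OF f s(1) x] never s(1) by blast
  qed
  then show "x \<in> dual_repeller X \<phi> (omega_limit X \<phi> U)" using x by (auto simp: dual_repeller_def)
qed

section \<open>Pseudo-orbits\<close>

definition jump ::
  "'a::metric_space set \<Rightarrow> (real \<Rightarrow> 'a \<Rightarrow> 'a) \<Rightarrow> real \<Rightarrow> real \<Rightarrow> ('a \<times> 'a) set" where
  "jump X \<phi> \<epsilon> T = {(x, y). x \<in> X \<and> y \<in> X \<and> dist (\<phi> T x) y < \<epsilon>}"

lemma relpow_loop_power:
  assumes "(p, p) \<in> R ^^ k"
  shows "(p, p) \<in> R ^^ (j * k)"
proof (induction j)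
  case (Suc j)
  with assms have "(p, p) \<in> R ^^ k O R ^^ (j * k)" by (rule relcompI)
  then show ?case by (simp add: relpow_add)
qed simp

text \<open>
  The elementary case of the coin problem for the coprime lengths \<open>k\<close> and \<open>k + 1\<close>: write
  \<open>n = q * k + r\<close> with \<open>r < k \<le> q\<close> and lengthen \<open>r\<close> of the \<open>q\<close> loops by one.
\<close>

lemma relpow_loop_consecutive:
  assumes k: "(p, p) \<in> R ^^ k" and k1: "(p, p) \<in> R ^^ Suc k" and n: "n \<ge> k * k" and "k > 0"
  shows "(p, p) \<in> R ^^ n"
proof -
  let ?q = "n div k" and ?r = "n mod k"
  have "?r < k" using \<open>k > 0\<close> by simp
  moreover have "k \<le> ?q" using div_le_mono[OF n, of k] \<open>k > 0\<close> by simp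
  ultimately have "?r \<le> ?q" by linarith
  then obtain d where d: "?q = ?r + d" using le_Suc_ex by blast
  have "n = ?q * k + ?r" by simp
  then have "n = d * k + ?r * Suc k" unfolding d by (simp add: algebra_simps)
  moreover have "(p, p) \<in> R ^^ (d * k + ?r * Suc k)"
    unfolding relpow_add
    using relpow_loop_power[OF k, of d] relpow_loop_power[OF k1, of ?r] by (rule relcompI)
  ultimately show ?thesis by (rule ssubst[of _ _ "\<lambda>m. (p, p) \<in> R ^^ m"])
qed

text \<open>
  Where the continuity of time enters: a change of the time by at most \<open>\<eta>\<close> costs an error of
  less than \<open>\<epsilon>\<close>, which a jump can make up for.
\<close>

lemma time_tolerance:
  assumes X: "compact X" and f: "flow_on X \<phi>" and e: "\<epsilon> > 0" and T: "T > 0"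
  obtains \<eta> where "\<eta> > 0"
    "\<And>x t. x \<in> X \<Longrightarrow> \<bar>t - T\<bar> \<le> \<eta> \<Longrightarrow> dist (\<phi> T x) (\<phi> t x) < \<epsilon>"
proof -
  have "uniformly_continuous_on ({0..2*T} \<times> X) (\<lambda>(t, x). \<phi> t x)"
    using f X unfolding flow_on_def
    by (intro compact_uniformly_continuous compact_Times) (auto elim!: continuous_on_subset)
  then obtain d where d: "d > 0" "\<And>p q. p \<in> {0..2*T} \<times> X \<Longrightarrow> q \<in> {0..2*T} \<times> X \<Longrightarrow>
      dist q p < d \<Longrightarrow> dist ((\<lambda>(t, x). \<phi> t x) q) ((\<lambda>(t, x). \<phi> t x) p) < \<epsilon>"
    unfolding uniformly_continuous_on_def using e by metis
  show ?thesis
  proof (rule that[of "min (d/2) (T/2)"])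
    \<comment> \<open>The bound \<open>T/2\<close> keeps the times in \<open>[0, 2T]\<close>, where the continuity is uniform.\<close>
    fix x t assume "x \<in> X" "\<bar>t - T\<bar> \<le> min (d/2) (T/2)"
    moreover then have "dist (t, x) (T, x) < d"
      using d(1) by (simp add: dist_Pair_Pair dist_real_def)
    moreover have "t \<ge> 0" "t \<le> 2 * T" using calculation(2) T by linarith+
    ultimately show "dist (\<phi> T x) (\<phi> t x) < \<epsilon>" using d(2)[of "(T, x)" "(t, x)"] T by (simp add: dist_commute)
  qed (use d T in auto)
qed

text \<open>
  An orbit segment cut into steps of length \<open>t\<close> close to \<open>T\<close> is a pseudo-orbit with steps of length
  \<open>T\<close>. Half of the allowed error pays for the change of the time, and the other half is left for the
  end point, which may vary in a whole ball.
\<close>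

lemma pseudo_orbit_of_orbit:
  assumes f: "flow_on X \<phi>" and tol: "\<And>x. x \<in> X \<Longrightarrow> dist (\<phi> T x) (\<phi> t x) < \<epsilon>/2"
    and "t \<ge> 0" and "\<epsilon> > 0" and x: "x \<in> X" and y: "y \<in> X"
    and d: "dist (\<phi> (real (Suc n) * t) x) y < \<epsilon>/2"
  shows "(x, y) \<in> jump X \<phi> \<epsilon> T ^^ Suc n"
proof -
  have advance: "\<phi> t (\<phi> (real m * t) x) = \<phi> (real (Suc m) * t) x" for m
    using flow_on_add[OF f, of t "real m * t" x] assms by (simp add: algebra_simps)
  have inX: "\<phi> (real m * t) x \<in> X" for m using flow_on_in[OF f] assms by simp
  have *: "(x, \<phi> (real m * t) x) \<in> jump X \<phi> \<epsilon> T ^^ m" for m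
  proof (induction m)
    case 0
    then show ?case using flow_on_zero[OF f x] by simp
  next
    case (Suc m)
    have "dist (\<phi> T (\<phi> (real m * t) x)) (\<phi> (real (Suc m) * t) x) < \<epsilon>"
      using tol[OF inX[of m]] \<open>\<epsilon> > 0\<close> unfolding advance by linarith
    then have "(\<phi> (real m * t) x, \<phi> (real (Suc m) * t) x) \<in> jump X \<phi> \<epsilon> T"
      using inX[of m] inX[of "Suc m"] by (simp add: jump_def)
    with Suc show ?case by auto
  qed
  have "dist (\<phi> T (\<phi> (real n * t) x)) y < \<epsilon>"
    using tol[OF inX[of n]] d
      dist_triangle[of "\<phi> T (\<phi> (real n * t) x)" y "\<phi> (real (Suc n) * t) x"]
    unfolding advance by linarith
  then have "(\<phi> (real n * t) x, y) \<in> jump X \<phi> \<epsilon> T" using inX[of n] y by (simp add: jump_def)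
  with *[of n] show ?thesis by auto
qed

text \<open>
  By compactness the orbit is close to one and the same point at two of the times \<open>n * M * T\<close>, and
  these times differ by at least \<open>M * T\<close>.
\<close>

lemma orbit_near_return:
  assumes X: "compact X" and f: "flow_on X \<phi>" and x: "x \<in> X" and e: "\<epsilon> > 0" and T: "T > 0" and M: "M > 0"
  obtains i k where "k \<ge> M" "dist (\<phi> (real (i + k) * T) x) (\<phi> (real i * T) x) < \<epsilon>"
proof -
  have "\<forall>n. \<phi> (real (n * M) * T) x \<in> X" using flow_on_in[OF f _ x] T by simp
  then obtain l r where r: "strict_mono r" "((\<lambda>n. \<phi> (real (n * M) * T) x) \<circ> r) \<longlonglongrightarrow> l"
    using X unfolding compact_def by metis
  have "\<epsilon>/2 > 0" using e by simp
  then obtain N where N: "\<And>n. n \<ge> N \<Longrightarrow> dist (\<phi> (real (r n * M) * T) x) l < \<epsilon>/2"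
    using r(2) unfolding lim_sequentially o_def by metis
  have lt: "r N < r (Suc N)" using r(1) by (simp add: strict_mono_def)
  have "dist (\<phi> (real (r (Suc N) * M) * T) x) (\<phi> (real (r N * M) * T) x) < \<epsilon>"
    using N[of N] N[of "Suc N"]
      dist_triangle2[of "\<phi> (real (r (Suc N) * M) * T) x" "\<phi> (real (r N * M) * T) x" l] by linarith
  moreover have "r (Suc N) * M = r N * M + (r (Suc N) - r N) * M"
    using lt by (simp add: diff_mult_distrib)
  moreover have "(r (Suc N) - r N) * M \<ge> M"
    using mult_le_mono1[of 1 "r (Suc N) - r N" M] lt by linarith
  ultimately show ?thesis using that by metis
qed

text \<open>
  From a reachable point \<open>u\<close> the flow runs through reachable points for every late time \<open>t\<close>: a large
  \<open>t\<close> is some integer multiple of a time within \<open>\<eta>\<close> of \<open>T\<close>, so that \<open>t\<close> takes a whole number of steps.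
  That number is added to all the numbers of steps that lead to \<open>u\<close>.
\<close>

lemma attracting_nbhd_eventually_reachable:
  assumes X: "compact X" and f: "flow_on X \<phi>" and e: "\<epsilon> > 0" and T: "T > 0"
  shows "attracting_nbhd X \<phi> {y \<in> X. \<forall>\<^sub>F n in sequentially. (x, y) \<in> jump X \<phi> \<epsilon> T ^^ n}"
    (is "attracting_nbhd X \<phi> ?P")
proof -
  have "\<epsilon>/2 > 0" using e by simp
  then obtain \<eta> where \<eta>: "\<eta> > 0"
    "\<And>x t. x \<in> X \<Longrightarrow> \<bar>t - T\<bar> \<le> \<eta> \<Longrightarrow> dist (\<phi> T x) (\<phi> t x) < \<epsilon>/2"
    using time_tolerance[OF X f _ T] by metis
  (* With n + 1 >= T / \<eta> steps, spreading a remainder of at most T over the steps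
     lengthens each of them by at most \<eta>. *)
  define \<tau> where "\<tau> = T * (T / \<eta> + 2)"
  have "\<tau> > 0" unfolding \<tau>_def using T \<eta> by (simp add: add_pos_pos)
  moreover have "y \<in> ?P" if t: "t \<ge> \<tau>" and u: "u \<in> ?P" and y: "y \<in> X" and d: "dist (\<phi> t u) y < \<epsilon>/2" for t u y
  proof -
    have tT: "t / T \<ge> T / \<eta> + 2" using t T unfolding \<tau>_def by (simp add: field_simps)
    have "T / \<eta> > 0" using T \<eta> by simp
    (* The number of steps is Suc n; the last one carries the free jump. *)
    define n where "n = nat \<lfloor>t / T\<rfloor> - 1"
    have n: "real (Suc n) \<le> t / T" "t / T < real (Suc n) + 1"
      using tT \<open>T / \<eta> > 0\<close> unfolding n_def by linarith+
    then have "real (Suc n) \<ge> T / \<eta>" using tT by linarith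
    then have Tn: "T \<le> \<eta> * real (Suc n)" using \<eta> by (simp add: field_simps)
    define s where "s = t / real (Suc n)"
    have s1: "s \<ge> T" using n(1) T unfolding s_def by (simp add: field_simps)
    have "t < T * real (Suc n) + T" using n(2) T by (simp add: field_simps)
    then have "t \<le> (T + \<eta>) * real (Suc n)" using Tn by (simp add: algebra_simps)
    then have "s \<le> T + \<eta>" unfolding s_def by (simp add: divide_le_eq)
    then have st: "\<bar>s - T\<bar> \<le> \<eta>" "s \<ge> 0" using s1 T by auto
    have "real (Suc n) * s = t" unfolding s_def by simp
    then have uy: "(u, y) \<in> jump X \<phi> \<epsilon> T ^^ Suc n"
      using pseudo_orbit_of_orbit[OF f \<eta>(2)[OF _ st(1)] st(2) e _ y, of u n] u d by simp
    obtain N where N: "\<And>m. m \<ge> N \<Longrightarrow> (x, u) \<in> jump X \<phi> \<epsilon> T ^^ m"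
      using u unfolding eventually_sequentially by blast
    have "(x, y) \<in> jump X \<phi> \<epsilon> T ^^ m" if "m \<ge> N + Suc n" for m
    proof -
      have eq: "m = (m - Suc n) + Suc n" and "m - Suc n \<ge> N" using that by simp_all
      then have "(x, y) \<in> jump X \<phi> \<epsilon> T ^^ ((m - Suc n) + Suc n)"
        unfolding relpow_add by (intro relcompI[OF N uy])
      then show ?thesis using eq by argo
    qed
    then show ?thesis using y unfolding eventually_sequentially by blast
  qed
  ultimately have "\<exists>\<tau>>0. \<exists>e>0. \<forall>t\<ge>\<tau>. \<forall>u\<in>?P. \<forall>y\<in>X. dist (\<phi> t u) y < e \<longrightarrow> y \<in> ?P"
    using \<open>\<epsilon>/2 > 0\<close> by (intro exI[of _ \<tau>] exI[of _ "\<epsilon>/2"] conjI ballI allI impI)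
  then show ?thesis unfolding attracting_nbhd_iff_margin[OF X f] by simp
qed

text \<open>
  The step that decouples the number of jumps from the elapsed time. The point \<open>p\<close> is the start of a
  near-return after time \<open>k * T\<close>. The same piece of orbit is traversed in \<open>k\<close> steps of length \<open>T\<close>
  and in \<open>k + 1\<close> steps of length \<open>k * T / (k + 1)\<close>; for \<open>k \<ge> T / \<eta>\<close> the latter is within the
  tolerance.
\<close>

lemma orbit_meets_eventually_reachable:
  assumes X: "compact X" and f: "flow_on X \<phi>" and x: "x \<in> X" and e: "\<epsilon> > 0" and T: "T > 0"
  obtains s where "s \<ge> 0" "\<forall>\<^sub>F n in sequentially. (x, \<phi> s x) \<in> jump X \<phi> \<epsilon> T ^^ n"
proof -
  have e2: "\<epsilon>/2 > 0" using e by simp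
  obtain \<eta> where \<eta>: "\<eta> > 0"
    "\<And>x t. x \<in> X \<Longrightarrow> \<bar>t - T\<bar> \<le> \<eta> \<Longrightarrow> dist (\<phi> T x) (\<phi> t x) < \<epsilon>/2"
    using time_tolerance[OF X f e2 T] by metis
  define M where "M = Suc (nat \<lceil>T / \<eta>\<rceil>)"
  have M: "M > 0" "real M \<ge> T / \<eta>" unfolding M_def by (simp, linarith)
  obtain i k where ik: "k \<ge> M" "dist (\<phi> (real (i + k) * T) x) (\<phi> (real i * T) x) < \<epsilon>/2"
    using orbit_near_return[OF X f x e2 T M(1)] by metis
  obtain j where j: "k = Suc j" using ik(1) M(1) by (cases k) auto
  define p where "p = \<phi> (real i * T) x"
  have p: "p \<in> X" unfolding p_def using flow_on_in[OF f _ x] T by simp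
  have ret: "dist (\<phi> (real k * T) p) p < \<epsilon>/2"
    using ik(2) flow_on_add[OF f, of "real k * T" "real i * T" x] T x
    unfolding p_def by (simp add: algebra_simps)
  let ?R = "jump X \<phi> \<epsilon> T"
  have loop: "(p, p) \<in> ?R ^^ k"
    unfolding j using pseudo_orbit_of_orbit[OF f, of T T \<epsilon> p p j] ret j T e p by simp
  have loop1: "(p, p) \<in> ?R ^^ Suc k"
  proof (rule pseudo_orbit_of_orbit[OF f])
    let ?s = "real k * T / real (Suc k)"
    show "?s \<ge> 0" using T by simp
    show "dist (\<phi> (real (Suc k) * ?s) p) p < \<epsilon>/2" using ret by (simp del: of_nat_Suc)
    have "?s - T = - (T / real (Suc k))" by (simp add: field_simps)
    moreover have "T / real (Suc k) \<le> \<eta>"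
    proof -
      have "real (Suc k) \<ge> T / \<eta>" using M(2) ik(1) by simp
      then show ?thesis using \<eta>(1) by (simp add: field_simps)
    qed
    ultimately have "\<bar>?s - T\<bar> \<le> \<eta>" using T by (simp del: of_nat_Suc)
    then show "dist (\<phi> T y) (\<phi> ?s y) < \<epsilon>/2" if "y \<in> X" for y using \<eta>(2)[OF that] by blast
  qed (use e p in auto)
  have start: "(x, p) \<in> ?R ^^ i"
  proof (cases i)
    case 0
    then show ?thesis using flow_on_zero[OF f x] by (simp add: p_def)
  next
    case (Suc m)
    then show ?thesis using pseudo_orbit_of_orbit[OF f, of T T \<epsilon> x p m] T e x p by (simp add: p_def)
  qed
  have "(x, p) \<in> ?R ^^ n" if "n \<ge> i + k * k" for n
  proof -
    have eq: "n = i + (n - i)" using that by simp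
    have "(p, p) \<in> ?R ^^ (n - i)"
      using relpow_loop_consecutive[OF loop loop1, of "n - i"] that j by simp
    with start have "(x, p) \<in> ?R ^^ (i + (n - i))" unfolding relpow_add by (rule relcompI)
    then show ?thesis using eq by argo
  qed
  then have "\<forall>\<^sub>F n in sequentially. (x, p) \<in> ?R ^^ n" unfolding eventually_sequentially by blast
  then show ?thesis using that[of "real i * T"] T by (simp add: p_def)
qed

section \<open>Recurrence and pseudo-orbits\<close>

text \<open>
  The preorder on points of which the order on recurrent components is the quotient.
\<close>

definition below :: "'a::metric_space set \<Rightarrow> (real \<Rightarrow> 'a \<Rightarrow> 'a) \<Rightarrow> 'a \<Rightarrow> 'a \<Rightarrow> bool" where
  "below X \<phi> y x \<longleftrightarrow> (\<forall>A\<in>attractors X \<phi>. x \<in> A \<longrightarrow> y \<in> A)"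

lemma recurrent_set_subset:
  assumes "compact X" "flow_on X \<phi>"
  shows "recurrent_set X \<phi> \<subseteq> X"
proof -
  have "attracting_nbhd X \<phi> X"
    unfolding attracting_nbhd_iff_margin[OF assms] by (intro conjI exI[of _ 1]) auto
  then have "omega_limit X \<phi> X \<in> attractors X \<phi>" by (auto simp: attractors_def)
  then have "recurrent_set X \<phi> \<subseteq> omega_limit X \<phi> X \<union> dual_repeller X \<phi> (omega_limit X \<phi> X)"
    by (auto simp: recurrent_set_def)
  also have "\<dots> \<subseteq> X" using omega_limit_subset by (simp add: dual_repeller_def)
  finally show ?thesis .
qed

text \<open>
  The limit set of the eventually reachable points is an attractor, contained in these points. The
  orbit of \<open>x\<close> meets them, so \<open>x\<close> is not in the dual repeller, and by recurrence is in the attractor;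
  then so is \<open>y\<close>.
\<close>

lemma below_imp_eventually_reachable:
  assumes X: "compact X" and f: "flow_on X \<phi>" and x: "x \<in> recurrent_set X \<phi>"
    and b: "below X \<phi> y x" and e: "\<epsilon> > 0" and T: "T > 0"
  shows "\<forall>\<^sub>F n in sequentially. (x, y) \<in> jump X \<phi> \<epsilon> T ^^ n"
proof -
  have xX: "x \<in> X" using x recurrent_set_subset[OF X f] by blast
  define P where "P = {y \<in> X. \<forall>\<^sub>F n in sequentially. (x, y) \<in> jump X \<phi> \<epsilon> T ^^ n}"
  have P: "attracting_nbhd X \<phi> P"
    unfolding P_def by (rule attracting_nbhd_eventually_reachable[OF X f e T])
  then have A: "omega_limit X \<phi> P \<in> attractors X \<phi>" by (auto simp: attractors_def)
  obtain s where s: "s \<ge> 0" "\<forall>\<^sub>F n in sequentially. (x, \<phi> s x) \<in> jump X \<phi> \<epsilon> T ^^ n"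
    using orbit_meets_eventually_reachable[OF X f xX e T] .
  then have "\<phi> s x \<in> P" unfolding P_def using flow_on_in[OF f s(1) xX] by simp
  then have "x \<notin> dual_repeller X \<phi> (omega_limit X \<phi> P)"
    using mem_dual_repeller_iff[OF X f P xX] s(1) by blast
  then have "x \<in> omega_limit X \<phi> P" using x A by (auto simp: recurrent_set_def)
  then have "y \<in> omega_limit X \<phi> P" using b A by (auto simp: below_def)
  then have "y \<in> P" using omega_limit_subset_attracting_nbhd[OF X f P] by blast
  then show ?thesis by (simp add: P_def)
qed

text \<open>
  Once \<open>\<epsilon>\<close> is below the margin of an attracting neighborhood \<open>U\<close> and \<open>T\<close> is large, a
  pseudo-orbit from \<open>x\<close> has all its later points in \<open>U\<close>, so its end point is within \<open>\<epsilon>\<close> of \<open>\<phi> r u\<close>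
  for some \<open>u \<in> U\<close> and some \<open>r\<close> about as large as \<open>T\<close>. As \<open>\<epsilon>\<close> and \<open>T\<close> are arbitrary, the end point is in
  the limit set of \<open>U\<close>. Nonempty pseudo-orbits are required, since \<open>x\<close> itself need not be in \<open>A\<close>.
\<close>

lemma reachable_imp_mem_attractor:
  assumes X: "compact X" and f: "flow_on X \<phi>" and A: "A \<in> attractors X \<phi>"
    and x: "x \<in> X" "x \<notin> dual_repeller X \<phi> A"
    and reach: "\<And>\<epsilon> T. \<epsilon> > 0 \<Longrightarrow> T > 0 \<Longrightarrow> \<exists>n. (x, y) \<in> jump X \<phi> \<epsilon> T ^^ Suc n"
  shows "y \<in> A"
proof -
  obtain U where U: "attracting_nbhd X \<phi> U" "A = omega_limit X \<phi> U"
    using A by (auto simp: attractors_def)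
  obtain \<tau> \<epsilon>\<^sub>0 where m: "U \<subseteq> X" "\<tau> > 0" "\<epsilon>\<^sub>0 > 0"
    "\<And>t u y. t \<ge> \<tau> \<Longrightarrow> u \<in> U \<Longrightarrow> y \<in> X \<Longrightarrow> dist (\<phi> t u) y < \<epsilon>\<^sub>0 \<Longrightarrow> y \<in> U"
    using attracting_nbhdE[OF X f U(1)] by metis
  obtain s where s: "s \<ge> 0" "\<phi> s x \<in> U" using mem_dual_repeller_iff[OF X f U(1) x(1)] x(2) U(2) by blast
  have "\<exists>r\<ge>t. \<exists>u\<in>U. dist (\<phi> r u) y < \<epsilon>" if t: "t \<ge> 0" and e: "\<epsilon> > 0" for t \<epsilon>
  proof -
    (* The orbit of x needs the time s to enter U, so its first step has only T - s to settle. *)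
    define T where "T = s + \<tau> + t"
    define \<delta> where "\<delta> = min \<epsilon> \<epsilon>\<^sub>0"
    have T: "T > 0" "T - s \<ge> \<tau>" "T \<ge> \<tau>" "T - s \<ge> t" "T \<ge> t" using s(1) m(2) t unfolding T_def by auto
    have \<delta>_le: "\<delta> \<le> \<epsilon>\<^sub>0" and "\<delta> > 0" using e m(3) by (simp_all add: \<delta>_def)
    have in_U: "z \<in> U \<and> (\<exists>r\<ge>t. \<exists>u\<in>U. dist (\<phi> r u) z < \<delta>)" if "(x, z) \<in> jump X \<phi> \<delta> T ^^ Suc n" for n z
      using that
    proof (induction n arbitrary: z)
      case 0
      then have z: "z \<in> X" "dist (\<phi> T x) z < \<delta>" by (auto simp: jump_def)
      have "\<phi> T x = \<phi> (T - s) (\<phi> s x)" using flow_on_add[OF f, of "T - s" s x] s(1) x(1) T(2) m(2) by simp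
      then have "dist (\<phi> (T - s) (\<phi> s x)) z < \<delta>" using z by simp
      then show ?case using m(4)[OF T(2) s(2) z(1)] \<open>dist (\<phi> (T - s) (\<phi> s x)) z < \<delta>\<close> s(2) T(4) \<delta>_le
        by (meson less_le_trans)
    next
      case (Suc n)
      obtain v where v: "(x, v) \<in> jump X \<phi> \<delta> T ^^ Suc n" "(v, z) \<in> jump X \<phi> \<delta> T"
        using Suc.prems by (rule relpow_Suc_E)
      then have "v \<in> U" using Suc.IH by blast
      moreover have "z \<in> X" "dist (\<phi> T v) z < \<delta>" using v by (auto simp: jump_def)
      ultimately show ?case using m(4)[OF T(3), of v z] T(5) \<delta>_le by (meson less_le_trans)
    qed
    obtain n where "(x, y) \<in> jump X \<phi> \<delta> T ^^ Suc n" using reach[OF \<open>\<delta> > 0\<close> T(1)] by blast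
    then obtain r u where "r \<ge> t" "u \<in> U" "dist (\<phi> r u) y < \<delta>" using in_U by blast
    then show ?thesis unfolding \<delta>_def by auto
  qed
  then show ?thesis using mem_omega_limit_iff[OF X f m(1)] U(2) by blast
qed

section \<open>Semiconjugacies\<close>

text \<open>
  The preimage of an attracting neighborhood is attracting, and orbits enter it exactly when their
  images enter the neighborhood downstairs. Only an inclusion \<open>h ` B \<subseteq> A\<close> is claimed for the
  attractors themselves: \<open>B\<close> may be smaller than the preimage of \<open>A\<close>, as a point over \<open>A\<close> need not
  have a backward orbit in \<open>X\<close>. On recurrent points the dual repellers make up the difference.
\<close>

lemma attractor_pullback:
  assumes X: "compact X" and f: "flow_on X \<phi>" and Y: "compact Y" and g: "flow_on Y \<psi>"
    and h: "continuous_on X h" and hX: "h ` X \<subseteq> Y"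
    and comm: "\<And>t x. t \<ge> 0 \<Longrightarrow> x \<in> X \<Longrightarrow> h (\<phi> t x) = \<psi> t (h x)"
    and A: "A \<in> attractors Y \<psi>"
  obtains B where "B \<in> attractors X \<phi>" "h ` B \<subseteq> A"
    "\<And>x. x \<in> X \<Longrightarrow> x \<in> dual_repeller X \<phi> B \<longleftrightarrow> h x \<in> dual_repeller Y \<psi> A"
proof -
  obtain U where U: "attracting_nbhd Y \<psi> U" and AU: "A = omega_limit Y \<psi> U"
    using A by (auto simp: attractors_def)
  obtain \<tau> \<epsilon> where UY: "U \<subseteq> Y" and m: "\<tau> > 0" "\<epsilon> > 0"
    "\<And>t u y. t \<ge> \<tau> \<Longrightarrow> u \<in> U \<Longrightarrow> y \<in> Y \<Longrightarrow> dist (\<psi> t u) y < \<epsilon> \<Longrightarrow> y \<in> U"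
    using attracting_nbhdE[OF Y g U] by metis
  have h_small: "\<exists>\<delta>>0. \<forall>x\<in>X. \<forall>y\<in>X. dist x y < \<delta> \<longrightarrow> dist (h x) (h y) < e" if "e > 0" for e
    using compact_uniformly_continuous[OF h X] that
    unfolding uniformly_continuous_on_def by (metis dist_commute)
  define V where "V = {x \<in> X. h x \<in> U}"
  have VX: "V \<subseteq> X" by (auto simp: V_def)
  have V: "attracting_nbhd X \<phi> V"
  proof -
    obtain \<delta> where \<delta>: "\<delta> > 0" "\<And>x y. x \<in> X \<Longrightarrow> y \<in> X \<Longrightarrow> dist x y < \<delta> \<Longrightarrow> dist (h x) (h y) < \<epsilon>"
      using h_small[OF m(2)] by blast
    have "y \<in> V" if t: "t \<ge> \<tau>" and v: "v \<in> V" and y: "y \<in> X" and d: "dist (\<phi> t v) y < \<delta>" for t v y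
    proof -
      have t0: "t \<ge> 0" using t m(1) by simp
      have vX: "v \<in> X" and vU: "h v \<in> U" using v by (auto simp: V_def)
      have "dist (h (\<phi> t v)) (h y) < \<epsilon>" using \<delta>(2)[OF flow_on_in[OF f t0 vX] y d] .
      then have "dist (\<psi> t (h v)) (h y) < \<epsilon>" using comm[OF t0 vX] by simp
      then have "h y \<in> U" using m(3)[OF t vU] hX y by blast
      then show "y \<in> V" using y by (simp add: V_def)
    qed
    then show ?thesis unfolding attracting_nbhd_iff_margin[OF X f] using VX m(1) \<delta>(1) by blast
  qed
  have "h b \<in> A" if b: "b \<in> omega_limit X \<phi> V" for b
  proof -
    have bX: "b \<in> X" using b omega_limit_subset by blast
    have "\<exists>s\<ge>t. \<exists>u\<in>U. dist (\<psi> s u) (h b) < e" if t: "t \<ge> 0" and e: "e > 0" for t e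
    proof -
      obtain \<delta> where \<delta>: "\<delta> > 0" "\<And>x y. x \<in> X \<Longrightarrow> y \<in> X \<Longrightarrow> dist x y < \<delta> \<Longrightarrow> dist (h x) (h y) < e"
        using h_small[OF e] by blast
      obtain s v where s: "s \<ge> t" "v \<in> V" "dist (\<phi> s v) b < \<delta>"
        using b t \<delta>(1) unfolding mem_omega_limit_iff[OF X f VX] by blast
      have vX: "v \<in> X" and s0: "s \<ge> 0" using s t VX by auto
      have "dist (\<psi> s (h v)) (h b) < e"
        using \<delta>(2)[OF flow_on_in[OF f s0 vX] bX s(3)] comm[OF s0 vX] by simp
      then show ?thesis using s unfolding V_def by blast
    qed
    then show ?thesis unfolding AU mem_omega_limit_iff[OF Y g UY] by blast
  qed
  moreover have "x \<in> dual_repeller X \<phi> (omega_limit X \<phi> V) \<longleftrightarrow> h x \<in> dual_repeller Y \<psi> A"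
    if x: "x \<in> X" for x
  proof -
    have hx: "h x \<in> Y" using hX x by blast
    have "\<phi> s x \<in> V \<longleftrightarrow> \<psi> s (h x) \<in> U" if "s \<ge> 0" for s
      using flow_on_in[OF f that x] comm[OF that x] by (simp add: V_def)
    then show ?thesis
      unfolding AU mem_dual_repeller_iff[OF X f V x] mem_dual_repeller_iff[OF Y g U hx] by blast
  qed
  moreover have "omega_limit X \<phi> V \<in> attractors X \<phi>" using V by (auto simp: attractors_def)
  ultimately show ?thesis using that[of "omega_limit X \<phi> V"] by blast
qed

lemma mem_recurrent_set_iff:
  assumes X: "compact X" and f: "flow_on X \<phi>"
  shows "x \<in> recurrent_set X \<phi> \<longleftrightarrow>
    x \<in> X \<and> (\<forall>A\<in>attractors X \<phi>. x \<in> A \<longleftrightarrow> x \<notin> dual_repeller X \<phi> A)"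
  using recurrent_set_subset[OF assms] attractor_disjoint_dual[OF assms]
  unfolding recurrent_set_def by blast

lemma semiconjugacy_recurrent_set:
  assumes X: "compact X" and f: "flow_on X \<phi>" and Y: "compact Y" and g: "flow_on Y \<psi>"
    and h: "continuous_on X h" and hX: "h ` X \<subseteq> Y"
    and comm: "\<And>t x. t \<ge> 0 \<Longrightarrow> x \<in> X \<Longrightarrow> h (\<phi> t x) = \<psi> t (h x)"
    and x: "x \<in> recurrent_set X \<phi>"
  shows "h x \<in> recurrent_set Y \<psi>"
proof -
  have xX: "x \<in> X" using x mem_recurrent_set_iff[OF X f] by blast
  have "h x \<in> A \<union> dual_repeller Y \<psi> A" if A: "A \<in> attractors Y \<psi>" for A
  proof -
    obtain B where B: "B \<in> attractors X \<phi>" "h ` B \<subseteq> A"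
      "\<And>x. x \<in> X \<Longrightarrow> x \<in> dual_repeller X \<phi> B \<longleftrightarrow> h x \<in> dual_repeller Y \<psi> A"
      using attractor_pullback[OF X f Y g h hX comm A] by blast
    then show ?thesis using x xX unfolding recurrent_set_def by blast
  qed
  then show ?thesis by (simp add: recurrent_set_def)
qed

lemma semiconjugacy_below:
  assumes X: "compact X" and f: "flow_on X \<phi>" and Y: "compact Y" and g: "flow_on Y \<psi>"
    and h: "continuous_on X h" and hX: "h ` X \<subseteq> Y"
    and comm: "\<And>t x. t \<ge> 0 \<Longrightarrow> x \<in> X \<Longrightarrow> h (\<phi> t x) = \<psi> t (h x)"
    and x: "x \<in> recurrent_set X \<phi>" and b: "below X \<phi> y x"
  shows "below Y \<psi> (h y) (h x)"
  unfolding below_def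
proof (intro ballI impI)
  fix A assume A: "A \<in> attractors Y \<psi>" and hx: "h x \<in> A"
  obtain B where B: "B \<in> attractors X \<phi>" "h ` B \<subseteq> A"
    "\<And>x. x \<in> X \<Longrightarrow> x \<in> dual_repeller X \<phi> B \<longleftrightarrow> h x \<in> dual_repeller Y \<psi> A"
    using attractor_pullback[OF X f Y g h hX comm A] by blast
  have "h x \<notin> dual_repeller Y \<psi> A" using attractor_disjoint_dual[OF Y g A] hx by blast
  then have "x \<in> B" using x B(1,3) unfolding mem_recurrent_set_iff[OF X f] by blast
  then show "h y \<in> A" using b B(1,2) unfolding below_def by blast
qed

section \<open>Product flows\<close>

lemma flow_on_prod_flow:
  assumes f: "flow_on X \<phi>" and g: "flow_on Y \<psi>"
  shows "flow_on (X \<times> Y) (prod_flow \<phi> \<psi>)"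
proof -
  have "continuous_on ({0..} \<times> (X \<times> Y)) ((\<lambda>(t, x). \<phi> t x) \<circ> (\<lambda>p. (fst p, fst (snd p))))"
    using f unfolding flow_on_def
    by (intro continuous_on_compose continuous_intros) (auto elim!: continuous_on_subset)
  moreover have "continuous_on ({0..} \<times> (X \<times> Y)) ((\<lambda>(t, x). \<psi> t x) \<circ> (\<lambda>p. (fst p, snd (snd p))))"
    using g unfolding flow_on_def
    by (intro continuous_on_compose continuous_intros) (auto elim!: continuous_on_subset)
  ultimately have "continuous_on ({0..} \<times> (X \<times> Y))
      (\<lambda>p. (\<phi> (fst p) (fst (snd p)), \<psi> (fst p) (snd (snd p))))"
    by (intro continuous_on_Pair) (simp_all add: o_def)
  then have "continuous_on ({0..} \<times> (X \<times> Y)) (\<lambda>(t, z). prod_flow \<phi> \<psi> t z)"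
    by (simp add: prod_flow_def case_prod_beta)
  then show ?thesis using f g by (auto simp: flow_on_def prod_flow_def)
qed

text \<open>
  The number of steps is the same in both factors: the reason for controlling it above.
\<close>

lemma relpow_Pair:
  fixes R :: "'a rel" and S :: "'b rel"
  assumes "(a, b) \<in> R ^^ n" "(c, d) \<in> S ^^ n"
    and "\<And>a b c d. (a, b) \<in> R \<Longrightarrow> (c, d) \<in> S \<Longrightarrow> ((a, c), (b, d)) \<in> Q"
  shows "((a, c), (b, d)) \<in> Q ^^ n"
  using assms(1,2)
proof (induction n arbitrary: b d)
  case (Suc n)
  obtain b' d' where "(a, b') \<in> R ^^ n" "(b', b) \<in> R" "(c, d') \<in> S ^^ n" "(d', d) \<in> S"
    using Suc.prems by auto
  then show ?case using Suc.IH assms(3) by (meson relpow_Suc_I)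
qed auto

lemma jump_Pair:
  assumes "(a, b) \<in> jump X \<phi> (\<epsilon>/2) T" "(c, d) \<in> jump Y \<psi> (\<epsilon>/2) T"
  shows "((a, c), (b, d)) \<in> jump (X \<times> Y) (prod_flow \<phi> \<psi>) \<epsilon> T"
proof -
  have "dist (\<phi> T a, \<psi> T c) (b, d) \<le> dist (\<phi> T a) b + dist (\<psi> T c) d"
    unfolding dist_Pair_Pair by (rule sqrt_sum_squares_le_sum) auto
  then show ?thesis using assms by (auto simp: jump_def prod_flow_def)
qed

lemma below_refl: "below X \<phi> x x"
  by (simp add: below_def)

text \<open>
  Both halves of the pseudo-orbit argument meet here. For \<open>x' = x\<close> and \<open>y' = y\<close> this is recurrence
  of the pair, and for general points it is monotonicity.
\<close>

lemma prod_flow_mem_attractor: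
  assumes X: "compact X" and f: "flow_on X \<phi>" and Y: "compact Y" and g: "flow_on Y \<psi>"
    and x: "x \<in> recurrent_set X \<phi>" "below X \<phi> x' x"
    and y: "y \<in> recurrent_set Y \<psi>" "below Y \<psi> y' y"
    and A: "A \<in> attractors (X \<times> Y) (prod_flow \<phi> \<psi>)"
    and notdual: "(x, y) \<notin> dual_repeller (X \<times> Y) (prod_flow \<phi> \<psi>) A"
  shows "(x', y') \<in> A"
proof (rule reachable_imp_mem_attractor[OF compact_Times[OF X Y] flow_on_prod_flow[OF f g] A _ notdual])
  show "(x, y) \<in> X \<times> Y" using x(1) y(1) recurrent_set_subset[OF X f] recurrent_set_subset[OF Y g] by blast
  fix \<epsilon> T :: real assume e: "\<epsilon> > 0" and T: "T > 0"
  have e2: "\<epsilon>/2 > 0" using e by simp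
  have "\<forall>\<^sub>F n in sequentially. (x, x') \<in> jump X \<phi> (\<epsilon>/2) T ^^ n"
    by (rule below_imp_eventually_reachable[OF X f x e2 T])
  moreover have "\<forall>\<^sub>F n in sequentially. (y, y') \<in> jump Y \<psi> (\<epsilon>/2) T ^^ n"
    by (rule below_imp_eventually_reachable[OF Y g y e2 T])
  ultimately have "\<forall>\<^sub>F n in sequentially.
      ((x, y), (x', y')) \<in> jump (X \<times> Y) (prod_flow \<phi> \<psi>) \<epsilon> T ^^ n"
    by eventually_elim (rule relpow_Pair[OF _ _ jump_Pair])
  then obtain N where "\<And>n. n \<ge> N \<Longrightarrow> ((x, y), (x', y')) \<in> jump (X \<times> Y) (prod_flow \<phi> \<psi>) \<epsilon> T ^^ n"
    unfolding eventually_sequentially by blast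
  then show "\<exists>n. ((x, y), (x', y')) \<in> jump (X \<times> Y) (prod_flow \<phi> \<psi>) \<epsilon> T ^^ Suc n"
    using le_SucI[OF order_refl, of N] by blast
qed

lemma
  assumes X: "compact X" and f: "flow_on X \<phi>" and Y: "compact Y" and g: "flow_on Y \<psi>"
  shows recurrent_set_prod_flow:
      "recurrent_set (X \<times> Y) (prod_flow \<phi> \<psi>) = recurrent_set X \<phi> \<times> recurrent_set Y \<psi>"
    and below_prod_flow_iff:
      "\<And>x y x' y'. x \<in> recurrent_set X \<phi> \<Longrightarrow> y \<in> recurrent_set Y \<psi> \<Longrightarrow>
        below (X \<times> Y) (prod_flow \<phi> \<psi>) (x', y') (x, y) \<longleftrightarrow> below X \<phi> x' x \<and> below Y \<psi> y' y"
proof -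
  let ?Z = "X \<times> Y" and ?\<Phi> = "prod_flow \<phi> \<psi>"
  note Z = compact_Times[OF X Y] flow_on_prod_flow[OF f g]
  have fst: "continuous_on ?Z fst" "fst ` ?Z \<subseteq> X"
      "\<And>t z. t \<ge> 0 \<Longrightarrow> z \<in> ?Z \<Longrightarrow> fst (?\<Phi> t z) = \<phi> t (fst z)"
    by (auto simp: prod_flow_def continuous_on_fst case_prod_beta)
  have snd: "continuous_on ?Z snd" "snd ` ?Z \<subseteq> Y"
      "\<And>t z. t \<ge> 0 \<Longrightarrow> z \<in> ?Z \<Longrightarrow> snd (?\<Phi> t z) = \<psi> t (snd z)"
    by (auto simp: prod_flow_def continuous_on_snd case_prod_beta)
  show rec: "recurrent_set ?Z ?\<Phi> = recurrent_set X \<phi> \<times> recurrent_set Y \<psi>"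
  proof (intro equalityI subsetI)
    fix z assume "z \<in> recurrent_set ?Z ?\<Phi>"
    then have "fst z \<in> recurrent_set X \<phi>" "snd z \<in> recurrent_set Y \<psi>"
      using semiconjugacy_recurrent_set[where h = fst and \<phi> = ?\<Phi> and \<psi> = \<phi>, OF Z X f fst]
        semiconjugacy_recurrent_set[where h = snd and \<phi> = ?\<Phi> and \<psi> = \<psi>, OF Z Y g snd]
      by blast+
    then show "z \<in> recurrent_set X \<phi> \<times> recurrent_set Y \<psi>" by (simp add: mem_Times_iff)
  next
    fix z assume "z \<in> recurrent_set X \<phi> \<times> recurrent_set Y \<psi>"
    then obtain x y where z: "z = (x, y)" "x \<in> recurrent_set X \<phi>" "y \<in> recurrent_set Y \<psi>" by blast
    have "z \<in> A \<union> dual_repeller ?Z ?\<Phi> A" if "A \<in> attractors ?Z ?\<Phi>" for A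
      using prod_flow_mem_attractor[OF X f Y g z(2) below_refl z(3) below_refl that] z(1) by blast
    then show "z \<in> recurrent_set ?Z ?\<Phi>" by (simp add: recurrent_set_def)
  qed
  fix x y x' y'
  assume x: "x \<in> recurrent_set X \<phi>" and y: "y \<in> recurrent_set Y \<psi>"
  have xy: "(x, y) \<in> recurrent_set ?Z ?\<Phi>" using rec x y by simp
  show "below ?Z ?\<Phi> (x', y') (x, y) \<longleftrightarrow> below X \<phi> x' x \<and> below Y \<psi> y' y"
  proof
    assume "below ?Z ?\<Phi> (x', y') (x, y)"
    then show "below X \<phi> x' x \<and> below Y \<psi> y' y"
      using semiconjugacy_below[where h = fst and \<phi> = ?\<Phi> and \<psi> = \<phi>, OF Z X f fst xy]
        semiconjugacy_below[where h = snd and \<phi> = ?\<Phi> and \<psi> = \<psi>, OF Z Y g snd xy]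
      by (metis fst_conv snd_conv)
  next
    assume b: "below X \<phi> x' x \<and> below Y \<psi> y' y"
    show "below ?Z ?\<Phi> (x', y') (x, y)"
      unfolding below_def
    proof (intro ballI impI)
      fix A assume A: "A \<in> attractors ?Z ?\<Phi>" "(x, y) \<in> A"
      then have "(x, y) \<notin> dual_repeller ?Z ?\<Phi> A" using attractor_disjoint_dual[OF Z] by blast
      then show "(x', y') \<in> A"
        using prod_flow_mem_attractor[OF X f Y g x _ y _ A(1)] b by blast
    qed
  qed
qed

section \<open>The poset of recurrent components\<close>

lemma recurrent_components_eq_image:
  "recurrent_components X \<phi> = (\<lambda>x. recurrent_equiv X \<phi> `` {x}) ` recurrent_set X \<phi>"
  by (auto simp: recurrent_components_def quotient_def)

lemma recurrent_equiv_iff_below: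
  assumes "compact X" "flow_on X \<phi>"
  shows "(x, y) \<in> recurrent_equiv X \<phi> \<longleftrightarrow>
    x \<in> recurrent_set X \<phi> \<and> y \<in> recurrent_set X \<phi> \<and> below X \<phi> x y \<and> below X \<phi> y x"
proof -
  have "(x \<in> A \<and> y \<in> A \<or> x \<in> dual_repeller X \<phi> A \<and> y \<in> dual_repeller X \<phi> A) \<longleftrightarrow> (x \<in> A \<longleftrightarrow> y \<in> A)"
    if "x \<in> recurrent_set X \<phi>" "y \<in> recurrent_set X \<phi>" "A \<in> attractors X \<phi>" for A
    using that mem_recurrent_set_iff[OF assms] by metis
  then show ?thesis unfolding recurrent_equiv_def below_def by blast
qed

lemma rc_order_class_iff_below:
  assumes X: "compact X" and f: "flow_on X \<phi>"
    and x: "x \<in> recurrent_set X \<phi>" and y: "y \<in> recurrent_set X \<phi>"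
  shows "(recurrent_equiv X \<phi> `` {x}, recurrent_equiv X \<phi> `` {y}) \<in> rc_order X \<phi> \<longleftrightarrow> below X \<phi> x y"
proof -
  have "recurrent_equiv X \<phi> `` {z} \<subseteq> A \<longleftrightarrow> z \<in> A"
    if "z \<in> recurrent_set X \<phi>" "A \<in> attractors X \<phi>" for z A
    using that recurrent_equiv_iff_below[OF X f, of z] unfolding below_def by blast
  moreover have "recurrent_equiv X \<phi> `` {z} \<in> recurrent_components X \<phi>"
    if "z \<in> recurrent_set X \<phi>" for z
    unfolding recurrent_components_def using that by (rule quotientI)
  ultimately show ?thesis using x y by (simp add: rc_order_def below_def)
qed

lemma recurrent_equiv_class_prod_flow:
  assumes X: "compact X" and f: "flow_on X \<phi>" and Y: "compact Y" and g: "flow_on Y \<psi>"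
    and x: "x \<in> recurrent_set X \<phi>" and y: "y \<in> recurrent_set Y \<psi>"
  shows "recurrent_equiv (X \<times> Y) (prod_flow \<phi> \<psi>) `` {(x, y)} =
    recurrent_equiv X \<phi> `` {x} \<times> recurrent_equiv Y \<psi> `` {y}"
proof -
  note Z = compact_Times[OF X Y] flow_on_prod_flow[OF f g]
  have "((x, y), (x', y')) \<in> recurrent_equiv (X \<times> Y) (prod_flow \<phi> \<psi>) \<longleftrightarrow>
      (x, x') \<in> recurrent_equiv X \<phi> \<and> (y, y') \<in> recurrent_equiv Y \<psi>" (is "?L \<longleftrightarrow> ?R") for x' y'
  proof (cases "x' \<in> recurrent_set X \<phi> \<and> y' \<in> recurrent_set Y \<psi>")
    case True
    then have "?L \<longleftrightarrow> (below X \<phi> x x' \<and> below Y \<psi> y y') \<and> (below X \<phi> x' x \<and> below Y \<psi> y' y)"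
      unfolding recurrent_equiv_iff_below[OF Z] recurrent_set_prod_flow[OF assms(1-4)]
      using x y below_prod_flow_iff[OF assms(1-4), of x' y' x y]
        below_prod_flow_iff[OF assms(1-4), of x y x' y'] by simp
    also have "\<dots> \<longleftrightarrow> ?R"
      unfolding recurrent_equiv_iff_below[OF X f] recurrent_equiv_iff_below[OF Y g]
      using x y True by blast
    finally show ?thesis .
  next
    case False
    then show ?thesis
      unfolding recurrent_equiv_iff_below[OF X f] recurrent_equiv_iff_below[OF Y g]
        recurrent_equiv_iff_below[OF Z] recurrent_set_prod_flow[OF assms(1-4)] by blast
  qed
  then show ?thesis by (simp add: set_eq_iff)
qed

text \<open>
  A component of the product flow is a rectangle of components, so it is recovered from its two
  projections.
\<close>

theorem theorem4p12:
  fixes X\<^sub>1 :: "'a::metric_space set" and X\<^sub>2 :: "'b::metric_space set"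
    and \<phi>\<^sub>1 :: "real \<Rightarrow> 'a \<Rightarrow> 'a" and \<phi>\<^sub>2 :: "real \<Rightarrow> 'b \<Rightarrow> 'b"
  assumes "compact X\<^sub>1" and "compact X\<^sub>2"
    and "flow_on X\<^sub>1 \<phi>\<^sub>1" and "flow_on X\<^sub>2 \<phi>\<^sub>2"
  shows "order_isomorphic
    (recurrent_components (X\<^sub>1 \<times> X\<^sub>2) (prod_flow \<phi>\<^sub>1 \<phi>\<^sub>2))
    (rc_order (X\<^sub>1 \<times> X\<^sub>2) (prod_flow \<phi>\<^sub>1 \<phi>\<^sub>2))
    (recurrent_components X\<^sub>1 \<phi>\<^sub>1 \<times> recurrent_components X\<^sub>2 \<phi>\<^sub>2)
    (prod_order (rc_order X\<^sub>1 \<phi>\<^sub>1) (rc_order X\<^sub>2 \<phi>\<^sub>2))"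
proof -
  let ?C = "recurrent_components (X\<^sub>1 \<times> X\<^sub>2) (prod_flow \<phi>\<^sub>1 \<phi>\<^sub>2)"
  let ?R\<^sub>1 = "recurrent_set X\<^sub>1 \<phi>\<^sub>1" and ?R\<^sub>2 = "recurrent_set X\<^sub>2 \<phi>\<^sub>2"
  define E where "E = recurrent_equiv (X\<^sub>1 \<times> X\<^sub>2) (prod_flow \<phi>\<^sub>1 \<phi>\<^sub>2)"
  define E\<^sub>1 where "E\<^sub>1 = recurrent_equiv X\<^sub>1 \<phi>\<^sub>1"
  define E\<^sub>2 where "E\<^sub>2 = recurrent_equiv X\<^sub>2 \<phi>\<^sub>2"
  define f where "f = (\<lambda>\<xi> :: ('a \<times> 'b) set. (fst ` \<xi>, snd ` \<xi>))"
  note X = assms(1,3,2,4)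
  note Z = compact_Times[OF X(1,3)] flow_on_prod_flow[OF X(2,4)]
  note rec = recurrent_set_prod_flow[OF X]
  have C: "?C = (\<lambda>(x, y). E `` {(x, y)}) ` (?R\<^sub>1 \<times> ?R\<^sub>2)"
    by (simp add: recurrent_components_eq_image rec E_def case_prod_beta)
  have C\<^sub>1: "recurrent_components X\<^sub>1 \<phi>\<^sub>1 = (\<lambda>x. E\<^sub>1 `` {x}) ` ?R\<^sub>1"
    by (simp add: recurrent_components_eq_image E\<^sub>1_def)
  have C\<^sub>2: "recurrent_components X\<^sub>2 \<phi>\<^sub>2 = (\<lambda>y. E\<^sub>2 `` {y}) ` ?R\<^sub>2"
    by (simp add: recurrent_components_eq_image E\<^sub>2_def)
  have class_Times: "E `` {(x, y)} = E\<^sub>1 `` {x} \<times> E\<^sub>2 `` {y}" if "x \<in> ?R\<^sub>1" "y \<in> ?R\<^sub>2" for x y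
    using recurrent_equiv_class_prod_flow[OF X that] unfolding E_def E\<^sub>1_def E\<^sub>2_def .
  have f: "f (E `` {(x, y)}) = (E\<^sub>1 `` {x}, E\<^sub>2 `` {y})" if xy: "x \<in> ?R\<^sub>1" "y \<in> ?R\<^sub>2" for x y
  proof -
    have "x \<in> E\<^sub>1 `` {x}" "y \<in> E\<^sub>2 `` {y}"
      using equiv_class_self[OF equiv_recurrent_equiv[OF X(1,2)] xy(1)]
        equiv_class_self[OF equiv_recurrent_equiv[OF X(3,4)] xy(2)] by (auto simp: E\<^sub>1_def E\<^sub>2_def)
    then show ?thesis unfolding f_def class_Times[OF xy] by (auto simp: fst_image_times snd_image_times)
  qed
  have "bij_betw f ?C (recurrent_components X\<^sub>1 \<phi>\<^sub>1 \<times> recurrent_components X\<^sub>2 \<phi>\<^sub>2)"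
    unfolding bij_betw_def
  proof
    show "inj_on f ?C"
    proof (rule inj_on_inverseI[where g = "\<lambda>(a, b). a \<times> b"])
      fix \<xi> assume "\<xi> \<in> ?C"
      then obtain x y where xy: "x \<in> ?R\<^sub>1" "y \<in> ?R\<^sub>2" "\<xi> = E `` {(x, y)}" unfolding C by blast
      show "(case f \<xi> of (a, b) \<Rightarrow> a \<times> b) = \<xi>"
        unfolding xy(3) f[OF xy(1,2)] prod.case by (rule class_Times[OF xy(1,2), symmetric])
    qed
    show "f ` ?C = recurrent_components X\<^sub>1 \<phi>\<^sub>1 \<times> recurrent_components X\<^sub>2 \<phi>\<^sub>2"
    proof -
      have "f ` ?C = (\<lambda>(x, y). (E\<^sub>1 `` {x}, E\<^sub>2 `` {y})) ` (?R\<^sub>1 \<times> ?R\<^sub>2)"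
        unfolding C image_image using f by (intro image_cong) auto
      also have "\<dots> = recurrent_components X\<^sub>1 \<phi>\<^sub>1 \<times> recurrent_components X\<^sub>2 \<phi>\<^sub>2"
        unfolding C\<^sub>1 C\<^sub>2 by force
      finally show ?thesis .
    qed
  qed
  moreover have "(\<xi>, \<eta>) \<in> rc_order (X\<^sub>1 \<times> X\<^sub>2) (prod_flow \<phi>\<^sub>1 \<phi>\<^sub>2) \<longleftrightarrow>
      (f \<xi>, f \<eta>) \<in> prod_order (rc_order X\<^sub>1 \<phi>\<^sub>1) (rc_order X\<^sub>2 \<phi>\<^sub>2)"
    if \<xi>: "\<xi> \<in> ?C" and \<eta>: "\<eta> \<in> ?C" for \<xi> \<eta>
  proof -
    obtain x y where xy: "x \<in> ?R\<^sub>1" "y \<in> ?R\<^sub>2" "\<xi> = E `` {(x, y)}" using \<xi> unfolding C by blast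
    obtain u v where uv: "u \<in> ?R\<^sub>1" "v \<in> ?R\<^sub>2" "\<eta> = E `` {(u, v)}" using \<eta> unfolding C by blast
    have "(x, y) \<in> recurrent_set (X\<^sub>1 \<times> X\<^sub>2) (prod_flow \<phi>\<^sub>1 \<phi>\<^sub>2)"
      "(u, v) \<in> recurrent_set (X\<^sub>1 \<times> X\<^sub>2) (prod_flow \<phi>\<^sub>1 \<phi>\<^sub>2)" using rec xy uv by auto
    then have "(\<xi>, \<eta>) \<in> rc_order (X\<^sub>1 \<times> X\<^sub>2) (prod_flow \<phi>\<^sub>1 \<phi>\<^sub>2) \<longleftrightarrow>
        below X\<^sub>1 \<phi>\<^sub>1 x u \<and> below X\<^sub>2 \<phi>\<^sub>2 y v"
      unfolding xy(3) uv(3) E_def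
      using rc_order_class_iff_below[OF Z] below_prod_flow_iff[OF X uv(1,2)] by simp
    also have "\<dots> \<longleftrightarrow> (f \<xi>, f \<eta>) \<in> prod_order (rc_order X\<^sub>1 \<phi>\<^sub>1) (rc_order X\<^sub>2 \<phi>\<^sub>2)"
      unfolding xy(3) uv(3) f[OF xy(1,2)] f[OF uv(1,2)] E\<^sub>1_def E\<^sub>2_def
      by (simp add: prod_order_def rc_order_class_iff_below[OF X(1,2) xy(1) uv(1)]
          rc_order_class_iff_below[OF X(3,4) xy(2) uv(2)])
    finally show ?thesis .
  qed
  ultimately show ?thesis unfolding order_isomorphic_def by blast
qed

end
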